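(* Let $v$ and $\lambda$ be positive integers and let $(X,\mathcal{B})$ be a triple system $\mathrm{TS}(v,\lambda)$. Then Xeno (the first player) has a winning strategy in Tic-Tac-Toe on $(X,\mathcal{B})$ if and only if $v\ge 5$.
   Context: A triple system $\mathrm{TS}(v,\lambda)$ (that is, a $\mathrm{BIBD}(v,3,\lambda)$) is a pair $(X,\mathcal{B})$ where $X$ is a set of $v$ points and $\mathcal{B}$ is a collection of 3-element subsets of $X$ (blocks; repeated blocks are allowed) such that every pair of distinct points of $X$ occurs in exactly $\lambda$ blocks, counted with multiplicity. Tic-Tac-Toe on a design: two players, Xeno (first) and Ophelia (second), alternately choose points not chosen before; the first player to have chosen all the points of some block wins. If all points are chosen and nobody has completed a block, the game is a draw. *)

theory Defs
  imports Main "HOL-Library.Multiset"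
begin

text \<open>Blocks form a multiset, so repeated blocks are allowed and counted with multiplicity.\<close>

definition triple_system :: "'a set \<Rightarrow> 'a set multiset \<Rightarrow> nat \<Rightarrow> nat \<Rightarrow> bool" where
  "triple_system X \<B> v l \<longleftrightarrow>
     finite X \<and> card X = v \<and>
     (\<forall>b \<in># \<B>. b \<subseteq> X \<and> card b = 3) \<and>
     (\<forall>x \<in> X. \<forall>y \<in> X. x \<noteq> y \<longrightarrow> size {# b \<in># \<B>. x \<in> b \<and> y \<in> b #} = l)"

text \<open>A position is the list of all points chosen so far, in chronological order. Indices start
  at 0, so Xeno's points are those at the even indices and Ophelia's those at the odd ones.\<close>

definition xeno_points :: "'a list \<Rightarrow> 'a set" where
  "xeno_points p = {p ! i | i. i < length p \<and> even i}"

definition ophelia_points :: "'a list \<Rightarrow> 'a set" where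
  "ophelia_points p = {p ! i | i. i < length p \<and> odd i}"

definition has_block :: "'a set multiset \<Rightarrow> 'a set \<Rightarrow> bool" where
  "has_block \<B> S \<longleftrightarrow> (\<exists>b \<in># \<B>. b \<subseteq> S)"

definition undecided :: "'a set multiset \<Rightarrow> 'a list \<Rightarrow> bool" where
  "undecided \<B> p \<longleftrightarrow> \<not> has_block \<B> (xeno_points p) \<and> \<not> has_block \<B> (ophelia_points p)"

text \<open>Play stops as soon as a block is completed: no proper initial segment of a position
  contains a completed block.\<close>

definition position :: "'a set \<Rightarrow> 'a set multiset \<Rightarrow> 'a list \<Rightarrow> bool" where
  "position X \<B> p \<longleftrightarrow>
     distinct p \<and> set p \<subseteq> X \<and> (\<forall>i < length p. undecided \<B> (take i p))"

definition finished :: "'a set \<Rightarrow> 'a set multiset \<Rightarrow> 'a list \<Rightarrow> bool" where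
  "finished X \<B> p \<longleftrightarrow> position X \<B> p \<and> (\<not> undecided \<B> p \<or> set p = X)"

text \<open>In a position only the player who moved last can own a block (blocks being nonempty), so
  a player owning a block is the first to have completed one.\<close>

definition xeno_wins :: "'a set \<Rightarrow> 'a set multiset \<Rightarrow> 'a list \<Rightarrow> bool" where
  "xeno_wins X \<B> p \<longleftrightarrow> finished X \<B> p \<and> has_block \<B> (xeno_points p)"

definition xeno_strategy :: "'a set \<Rightarrow> 'a set multiset \<Rightarrow> ('a list \<Rightarrow> 'a) \<Rightarrow> bool" where
  "xeno_strategy X \<B> \<sigma> \<longleftrightarrow>
     (\<forall>p. position X \<B> p \<and> \<not> finished X \<B> p \<and> even (length p) \<longrightarrow> \<sigma> p \<in> X - set p)"

definition follows :: "('a list \<Rightarrow> 'a) \<Rightarrow> 'a list \<Rightarrow> bool" where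
  "follows \<sigma> p \<longleftrightarrow> (\<forall>i < length p. even i \<longrightarrow> p ! i = \<sigma> (take i p))"

definition xeno_winning_strategy :: "'a set \<Rightarrow> 'a set multiset \<Rightarrow> ('a list \<Rightarrow> 'a) \<Rightarrow> bool" where
  "xeno_winning_strategy X \<B> \<sigma> \<longleftrightarrow>
     xeno_strategy X \<B> \<sigma> \<and>
     (\<forall>p. finished X \<B> p \<and> follows \<sigma> p \<longrightarrow> xeno_wins X \<B> p)"

end

theory Submission
  imports Defs
begin

text \<open>
  For \<open>v \<le> 4\<close> Xeno never owns three points. For \<open>v \<ge> 5\<close> write \<open>N a b\<close> for the set of points
  completing \<open>a, b\<close> to a block. After the moves \<open>x, y\<close> Xeno wins at once if some \<open>z\<close> has two
  elements in \<open>N x z - {y}\<close>; call \<open>y\<close> bad for \<open>x\<close> if there is no such \<open>z\<close>. An opening \<open>x\<close> without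
  bad replies wins, so suppose that every point has a bad reply. If all sets \<open>N a b\<close> are
  singletons, play as in a Steiner triple system: force Ophelia to complete the line through \<open>x, z\<close>,
  then block her line, which creates two threats. Otherwise open with an \<open>x\<close> for which some
  \<open>N x a\<close> has at least two elements, and let \<open>y\<close> be bad for \<open>x\<close>. Deleting \<open>y\<close> from the link graph
  of \<open>x\<close> leaves a perfect matching, and its edges inside \<open>N x y\<close> form triangles with \<open>y\<close>. For such
  an edge \<open>z, w\<close> all four triples in \<open>{x, y, z, w}\<close> are blocks, and \<open>N y w = {x, z}\<close> after possibly
  exchanging \<open>z\<close> and \<open>w\<close>. So Xeno plays \<open>z\<close>, Ophelia must answer \<open>w\<close> without making a threat, and any
  further \<open>t\<close> is matched to some \<open>c\<close> in the link of \<open>x\<close> and to some \<open>d\<close> in the link of \<open>z\<close>. Here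
  \<open>c \<noteq> d\<close>, because \<open>{x, t, c}\<close> and \<open>{z, t, d}\<close> each have multiplicity greater than \<open>\<lambda>/2\<close>.
\<close>

section \<open>Points owned by the two players, and finished plays\<close>

lemma xeno_points_Nil [simp]: "xeno_points [] = {}"
  by (simp add: xeno_points_def)

lemma ophelia_points_Nil [simp]: "ophelia_points [] = {}"
  by (simp add: ophelia_points_def)

text \<open>Prepending a move shifts every index by one, so the players swap parities.\<close>

lemma xeno_points_Cons [simp]: "xeno_points (a # p) = insert a (ophelia_points p)"
proof -
  have "{(a # p) ! i | i. i < length (a # p) \<and> even i} = insert a {p ! i | i. i < length p \<and> odd i}"
    (is "?L = ?R")
  proof (intro equalityI subsetI)
    fix u assume "u \<in> ?L"
    then obtain i where "u = (a # p) ! i" "i < length (a # p)" "even i" by blast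
    then show "u \<in> ?R" by (cases i) auto
  next
    fix u assume "u \<in> ?R"
    then consider "u = a" | i where "u = p ! i" "i < length p" "odd i" by blast
    then show "u \<in> ?L"
    proof cases
      case 1
      then show ?thesis by (auto intro!: exI[of _ 0])
    next
      case 2
      then show ?thesis by (auto intro!: exI[of _ "Suc i"])
    qed
  qed
  then show ?thesis by (simp only: xeno_points_def ophelia_points_def)
qed

lemma ophelia_points_Cons [simp]: "ophelia_points (a # p) = xeno_points p"
proof -
  have "{(a # p) ! i | i. i < length (a # p) \<and> odd i} = {p ! i | i. i < length p \<and> even i}"
    (is "?L = ?R")
  proof (intro equalityI subsetI)
    fix u assume "u \<in> ?L"
    then obtain i where "u = (a # p) ! i" "i < length (a # p)" "odd i" by blast
    then show "u \<in> ?R" by (cases i) auto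
  next
    fix u assume "u \<in> ?R"
    then obtain i where "u = p ! i" "i < length p" "even i" by blast
    then show "u \<in> ?L" by (auto intro!: exI[of _ "Suc i"])
  qed
  then show ?thesis by (simp only: xeno_points_def ophelia_points_def)
qed

lemma points_append1:
  "xeno_points (p @ [a]) = (if even (length p) then insert a (xeno_points p) else xeno_points p)"
  "ophelia_points (p @ [a]) = (if even (length p) then ophelia_points p else insert a (ophelia_points p))"
  by (induction p) auto

lemma finite_points: "finite (xeno_points p)" "finite (ophelia_points p)"
  by (simp_all add: xeno_points_def ophelia_points_def)

lemma card_xeno_ophelia_points_le:
  "card (xeno_points p) \<le> (length p + 1) div 2 \<and> card (ophelia_points p) \<le> length p div 2"
proof (induction p)
  case (Cons a p)
  then have "card (insert a (ophelia_points p)) \<le> Suc (length p div 2)"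
    by (simp add: card_insert_if finite_points)
  then show ?case using Cons by auto
qed simp

lemma position_append1:
  assumes "position X \<B> p" "undecided \<B> p" "a \<in> X - set p"
  shows "position X \<B> (p @ [a])"
  using assms by (auto simp: position_def less_Suc_eq)

lemma follows_append1:
  assumes "follows \<sigma> p" "even (length p) \<Longrightarrow> a = \<sigma> p"
  shows "follows \<sigma> (p @ [a])"
  using assms by (auto simp: follows_def less_Suc_eq nth_append)

text \<open>A longest position following \<open>\<sigma>\<close> is finished. This excludes that a
  winning strategy wins only vacuously.\<close>

lemma exists_finished_follows:
  assumes "finite X" "xeno_strategy X \<B> \<sigma>"
  shows "\<exists>p. finished X \<B> p \<and> follows \<sigma> p"
proof -
  let ?P = "\<lambda>p. position X \<B> p \<and> follows \<sigma> p"
  have "?P []" by (simp add: position_def follows_def)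
  moreover have "\<forall>p. ?P p \<longrightarrow> length p \<le> card X"
    using assms(1) by (metis card_mono distinct_card position_def)
  ultimately obtain p where p: "?P p" and max: "\<And>q. ?P q \<Longrightarrow> length q \<le> length p"
    using ex_has_greatest_nat[of ?P "[]" length "Suc (card X)"] by (metis le_imp_less_Suc less_imp_le)
  have "finished X \<B> p"
  proof (rule ccontr)
    assume nf: "\<not> finished X \<B> p"
    then have und: "undecided \<B> p" and "set p \<noteq> X" using p by (auto simp: finished_def)
    moreover have "set p \<subseteq> X" using p by (simp add: position_def)
    ultimately obtain b where b: "b \<in> X - set p" by blast
    define a where "a = (if even (length p) then \<sigma> p else b)"
    have "a \<in> X - set p"
      using assms(2) p nf b by (auto simp: a_def xeno_strategy_def)
    then have "?P (p @ [a])"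
      using p und by (auto intro!: position_append1 follows_append1 simp: a_def)
    then show False using max by fastforce
  qed
  with p show ?thesis by blast
qed

section \<open>From forced wins to strategies\<close>

text \<open>Positions with Xeno to move from which he can force a win; the premise
  \<open>insert a (set p) \<noteq> X\<close> excludes a draw at his move.\<close>

inductive xeno_forces :: "'a set \<Rightarrow> 'a set multiset \<Rightarrow> 'a list \<Rightarrow> bool" for X \<B> where
  complete: "\<lbrakk>undecided \<B> p; even (length p); a \<in> X - set p; has_block \<B> (xeno_points (p @ [a]))\<rbrakk>
    \<Longrightarrow> xeno_forces X \<B> p"
| continue: "\<lbrakk>undecided \<B> p; even (length p); a \<in> X - set p; insert a (set p) \<noteq> X;
    \<And>b. b \<in> X - insert a (set p) \<Longrightarrow> xeno_forces X \<B> (p @ [a, b])\<rbrakk>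
    \<Longrightarrow> xeno_forces X \<B> p"

lemma xeno_forces_imp_winning_strategy:
  assumes "xeno_forces X \<B> []"
  shows "\<exists>\<sigma>. xeno_winning_strategy X \<B> \<sigma>"
proof -
  let ?good = "\<lambda>p a. a \<in> X - set p \<and> (has_block \<B> (xeno_points (p @ [a])) \<or>
    insert a (set p) \<noteq> X \<and> (\<forall>b \<in> X - insert a (set p). xeno_forces X \<B> (p @ [a, b])))"
  \<comment> \<open>A strategy must be legal everywhere, so any free point is taken where no win is
    forced.\<close>
  define \<sigma> where "\<sigma> p = (if xeno_forces X \<B> p then SOME a. ?good p a else SOME a. a \<in> X - set p)" for p
  have good: "?good p (\<sigma> p)" if "xeno_forces X \<B> p" for p
  proof -
    from that have "\<exists>a. ?good p a" by cases blast+
    then show ?thesis unfolding \<sigma>_def using that by (simp only: if_True) (rule someI_ex)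
  qed
  have forcesD: "undecided \<B> p \<and> even (length p) \<and> set p \<noteq> X" if "xeno_forces X \<B> p" for p
    using that by cases auto
  have "xeno_strategy X \<B> \<sigma>"
    unfolding xeno_strategy_def
  proof (intro allI impI)
    fix p assume p: "position X \<B> p \<and> \<not> finished X \<B> p \<and> even (length p)"
    show "\<sigma> p \<in> X - set p"
    proof (cases "xeno_forces X \<B> p")
      case False
      have "\<exists>a. a \<in> X - set p" using p by (auto simp: finished_def position_def)
      then have "(SOME a. a \<in> X - set p) \<in> X - set p" by (rule someI_ex)
      then show ?thesis using False by (simp add: \<sigma>_def)
    qed (use good in blast)
  qed
  moreover have "xeno_wins X \<B> p" if fin: "finished X \<B> p" and fol: "follows \<sigma> p" for p
  proof (rule ccontr)
    assume "\<not> xeno_wins X \<B> p"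
    then have nb: "\<not> has_block \<B> (xeno_points p)" using fin by (simp add: xeno_wins_def)
    have pos: "position X \<B> p" using fin by (simp add: finished_def)
    \<comment> \<open>If Xeno did not win, play would keep returning to positions from which he
      forces a win, so it would never end.\<close>
    have "2 * k \<le> length p \<and> xeno_forces X \<B> (take (2 * k) p)" for k
    proof (induction k)
      case 0
      then show ?case using assms by simp
    next
      case (Suc k)
      define q where "q = take (2 * k) p"
      have q: "xeno_forces X \<B> q" using Suc by (simp add: q_def)
      have "2 * k \<noteq> length p" using forcesD[OF q] fin by (auto simp: q_def finished_def)
      then have lt: "2 * k < length p" using Suc by simp
      define a where "a = p ! (2 * k)"
      have "a = \<sigma> q" using fol lt by (simp add: follows_def a_def q_def)
      then have ga: "?good q a" using good[OF q] by simp
      have take1: "take (Suc (2 * k)) p = q @ [a]"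
        using lt by (simp add: q_def a_def take_Suc_conv_app_nth)
      have noblock: "\<not> has_block \<B> (xeno_points (q @ [a]))"
      proof (cases "Suc (2 * k) = length p")
        case True
        then show ?thesis using nb take1 by simp
      next
        case False
        then have "undecided \<B> (take (Suc (2 * k)) p)" using pos lt by (simp add: position_def)
        then show ?thesis using take1 by (simp add: undecided_def)
      qed
      then have step: "insert a (set q) \<noteq> X" "\<And>b. b \<in> X - insert a (set q) \<Longrightarrow> xeno_forces X \<B> (q @ [a, b])"
        using ga by blast+
      have "Suc (2 * k) \<noteq> length p"
      proof
        assume "Suc (2 * k) = length p"
        then have "p = q @ [a]" using take1 by simp
        moreover have "undecided \<B> (q @ [a])"
          using noblock forcesD[OF q] by (simp add: undecided_def points_append1)
        ultimately show False using fin step by (simp add: finished_def)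
      qed
      then have lt2: "Suc (2 * k) < length p" using lt by simp
      define b where "b = p ! Suc (2 * k)"
      have take2: "take (2 * Suc k) p = q @ [a, b]"
        using take_Suc_conv_app_nth[OF lt2] take1 by (simp add: b_def)
      have "distinct (q @ [a, b])" "set (q @ [a, b]) \<subseteq> X"
        using pos take2 by (metis distinct_take position_def, metis set_take_subset subset_trans position_def)
      then show ?case using step lt2 take2 by auto
    qed
    from this[of "Suc (length p)"] show False by simp
  qed
  ultimately show ?thesis unfolding xeno_winning_strategy_def by blast
qed

section \<open>Multiplicities and link graphs\<close>

locale covering_triple_system =
  fixes X :: "'a set" and \<B> :: "'a set multiset" and v l :: nat
  assumes triple_system: "triple_system X \<B> v l" and l_pos: "l > 0"
begin

definition wt :: "'a \<Rightarrow> 'a \<Rightarrow> 'a \<Rightarrow> nat" where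
  "wt a b c = count \<B> {a, b, c}"

text \<open>The neighbourhood of \<open>b\<close> in the link graph of \<open>a\<close>, whose edge
  \<open>b, c\<close> has weight \<open>wt a b c\<close>.\<close>

definition N :: "'a \<Rightarrow> 'a \<Rightarrow> 'a set" where
  "N a b = {c. {a, b, c} \<in># \<B>}"

lemma finite_X: "finite X"
  using triple_system by (simp add: triple_system_def)

lemma N_perm: "c \<in> N a b \<longleftrightarrow> c \<in> N b a" "c \<in> N a b \<longleftrightarrow> b \<in> N a c"
  by (auto simp: N_def insert_commute)

lemma wt_perm: "wt a b c = wt b a c" "wt a b c = wt a c b"
  by (auto simp: wt_def insert_commute)

lemma wt_pos_iff: "0 < wt a b c \<longleftrightarrow> c \<in> N a b"
  by (simp add: wt_def N_def)

lemma N_D: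
  assumes "c \<in> N a b"
  shows "a \<in> X" "b \<in> X" "c \<in> X" "a \<noteq> b" "a \<noteq> c" "b \<noteq> c"
proof -
  have *: "{a, b, c} \<subseteq> X" "card {a, b, c} = 3"
    using assms triple_system by (auto simp: N_def triple_system_def)
  then show "a \<in> X" "b \<in> X" "c \<in> X" by auto
  show "a \<noteq> b" "a \<noteq> c" "b \<noteq> c" using *(2) by (auto simp: card_insert_if split: if_splits)
qed

text \<open>Blocks through \<open>a, b\<close> are counted by their third point. Hence every
  weighted link graph is \<open>l\<close>-regular.\<close>

lemma sum_wt:
  assumes "a \<in> X" "b \<in> X" "a \<noteq> b"
  shows "(\<Sum>c\<in>X. wt a b c) = l"
proof -
  let ?M = "{# s \<in># \<B>. a \<in> s \<and> b \<in> s #}"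
  let ?f = "\<lambda>c. {a, b, c}"
  have inj: "inj_on ?f (X - {a, b})" by (auto simp: inj_on_def)
  have sub: "set_mset ?M \<subseteq> ?f ` (X - {a, b})"
  proof
    fix s assume "s \<in># ?M"
    then have s: "a \<in> s" "b \<in> s" "s \<subseteq> X" "card s = 3"
      using triple_system by (auto simp: triple_system_def)
    then have "card (s - {a, b}) = 1" using assms(3) by (subst card_Diff_subset) auto
    then obtain c where "s - {a, b} = {c}" by (auto simp: card_1_singleton_iff)
    then show "s \<in> ?f ` (X - {a, b})" using s by (intro image_eqI[of _ _ c]) auto
  qed
  have "l = size ?M" using triple_system assms by (simp add: triple_system_def)
  also have "\<dots> = sum (count ?M) (set_mset ?M)" by (simp add: size_multiset_overloaded_eq)
  also have "\<dots> = sum (count ?M) (?f ` (X - {a, b}))"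
    by (rule sum.mono_neutral_left) (use sub finite_X in \<open>auto simp: not_in_iff\<close>)
  also have "\<dots> = (\<Sum>c\<in>X - {a, b}. wt a b c)"
    by (simp add: sum.reindex[OF inj] wt_def)
  also have "\<dots> = (\<Sum>c\<in>X. wt a b c)"
  proof (rule sum.mono_neutral_left)
    show "\<forall>c\<in>X - (X - {a, b}). wt a b c = 0"
    proof
      fix c assume "c \<in> X - (X - {a, b})"
      then have "c \<notin> N a b" using N_D(5,6) by blast
      then show "wt a b c = 0" using wt_pos_iff neq0_conv by blast
    qed
  qed (use finite_X in auto)
  finally show ?thesis by simp
qed

lemma sum_wt_le:
  assumes "a \<in> X" "b \<in> X" "a \<noteq> b" "S \<subseteq> X"
  shows "(\<Sum>c\<in>S. wt a b c) \<le> l"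
  using sum_wt[OF assms(1-3)] sum_mono2[OF finite_X assms(4), of "wt a b"] by simp

lemma sum_wt_eq:
  assumes "a \<in> X" "b \<in> X" "a \<noteq> b" "S \<subseteq> X" "N a b \<subseteq> S"
  shows "(\<Sum>c\<in>S. wt a b c) = l"
proof -
  have "(\<Sum>c\<in>S. wt a b c) = (\<Sum>c\<in>X. wt a b c)"
    by (rule sum.mono_neutral_left) (use finite_X assms wt_pos_iff in blast)+
  then show ?thesis using sum_wt assms by simp
qed

lemma N_nonempty:
  assumes "a \<in> X" "b \<in> X" "a \<noteq> b"
  obtains c where "c \<in> N a b"
  using sum_wt_eq[OF assms, of "{}"] l_pos by fastforce

section \<open>Bad replies\<close>

definition bad :: "'a \<Rightarrow> 'a \<Rightarrow> bool" where
  "bad x y \<longleftrightarrow> y \<in> X - {x} \<and>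
     (\<forall>z\<in>X - {x, y}. \<forall>c\<in>N x z - {y}. \<forall>d\<in>N x z - {y}. c = d)"

text \<open>For \<open>x \<in> X\<close>, \<open>N_nonempty\<close> makes this say that the link
  graph of \<open>x\<close> is a perfect matching.\<close>

definition matched :: "'a \<Rightarrow> bool" where
  "matched x \<longleftrightarrow> (\<forall>z\<in>X - {x}. \<forall>c\<in>N x z. \<forall>d\<in>N x z. c = d)"

text \<open>If \<open>z\<close> had no partner, all blocks on \<open>x, z\<close> would be \<open>{x, y, z}\<close>, exhausting the pair \<open>x, y\<close>;
  then the whole link of \<open>x\<close> would be a matching.\<close>

lemma bad_partner:
  assumes "x \<in> X" "bad x y" "\<not> matched x" "z \<in> X - {x, y}"
  obtains w where "w \<in> N x z" "w \<noteq> y"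
proof (rule ccontr)
  assume "\<not> thesis"
  then have sub: "N x z \<subseteq> {y}" using that by blast
  have y: "y \<in> X - {x}" using assms(2) unfolding bad_def by blast
  have "wt x z y = l" using sum_wt_eq[of x z "{y}"] sub assms y by auto
  then have eq: "wt x y z = l" by (metis wt_perm)
  have yz: "c = z" if "c \<in> N x y" for c
  proof (rule ccontr)
    assume "c \<noteq> z"
    then have "wt x y z + wt x y c \<le> l"
      using sum_wt_le[of x y "{z, c}"] N_D[OF that] assms(4) y by simp
    then show False using eq that by (simp flip: wt_pos_iff)
  qed
  have "matched x"
    unfolding matched_def
  proof (intro ballI)
    fix u c d assume u: "u \<in> X - {x}" "c \<in> N x u" "d \<in> N x u"
    show "c = d"
    proof (cases "u = y \<or> u = z")
      case True
      then show ?thesis using u yz sub by blast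
    next
      case False
      then have "y \<notin> N x u" using yz N_perm by blast
      then show ?thesis using u False assms(2) unfolding bad_def by blast
    qed
  qed
  then show False using assms by simp
qed

text \<open>By regularity at \<open>z\<close> and at its partner \<open>w\<close>, both have the
  same weight left for their edges to \<open>y\<close>; it is positive for \<open>z\<close>, hence
  for \<open>w\<close>.\<close>

lemma bad_triangle:
  assumes "x \<in> X" "bad x y" "\<not> matched x" "z \<in> N x y"
  obtains w where "w \<noteq> y" "w \<noteq> z" "N x z = {w, y}" "N x w = {z, y}"
proof -
  note z = N_D[OF assms(4)]
  obtain w where w: "w \<in> N x z" "w \<noteq> y" using bad_partner[of x y z] assms z by blast
  note wD = N_D[OF w(1)]
  have yz: "y \<in> N x z" "z \<in> N x w" using assms(4) w N_perm by blast+
  have Nz: "N x z = {w, y}" using assms(2) w z yz unfolding bad_def by blast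
  have Nw: "N x w \<subseteq> {z, y}" using assms(2) w wD z yz unfolding bad_def by blast
  have "wt x z w + wt x z y = l" using sum_wt_eq[of x z "{w, y}"] Nz w z wD by simp
  moreover have "wt x w z + wt x w y = l" using sum_wt_eq[of x w "{z, y}"] Nw w z wD by simp
  ultimately have "wt x w y = wt x z y" by (simp add: wt_perm(2)[of x w z])
  then have "y \<in> N x w" using yz by (simp flip: wt_pos_iff)
  then show thesis using that w wD Nz Nw yz by blast
qed

text \<open>By regularity, \<open>p\<close> and \<open>p'\<close> each send weight
  \<open>l - wt x p p'\<close> to \<open>y\<close>. The edge to \<open>q\<close> uses some of the
  total weight \<open>l\<close> at \<open>y\<close>, so twice that amount is below
  \<open>l\<close>.\<close>

lemma bad_heavy:
  assumes "bad x y" "p \<noteq> y" "p' \<in> N x p" "p' \<noteq> y" "q \<in> N x y" "q \<noteq> p" "q \<noteq> p'"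
  shows "2 * wt x p p' > l"
proof -
  note p = N_D[OF assms(3)] and q = N_D[OF assms(5)]
  have "p \<in> N x p'" using assms N_perm by blast
  then have "N x p \<subseteq> {p', y}" "N x p' \<subseteq> {p, y}"
    using assms p unfolding bad_def by blast+
  then have "wt x p p' + wt x p y = l" "wt x p' p + wt x p' y = l"
    using sum_wt_eq[of x p "{p', y}"] sum_wt_eq[of x p' "{p, y}"] p q assms by auto
  moreover have "wt x y p + wt x y p' + wt x y q \<le> l"
    using sum_wt_le[of x y "{p, p', q}"] p q assms by (simp add: eval_nat_numeral)
  moreover have "wt x y q > 0" using assms by (simp add: wt_pos_iff)
  ultimately show ?thesis
    using wt_perm(2)[of x p p'] wt_perm(2)[of x y p] wt_perm(2)[of x y p'] by linarith
qed

text \<open>Unless \<open>c\<close> is one of \<open>x, y, w\<close>, the point \<open>x\<close>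
  keeps two neighbours after deleting \<open>c\<close> from the link of \<open>z\<close>. In each
  remaining case \<open>bad_triangle\<close> makes \<open>x, y, w\<close> a triangle in that
  link.\<close>

lemma N_pair_adjacent:
  assumes "z \<in> X" "bad z c" "\<not> matched z" "N z x = {w, y}" "w \<noteq> y"
  shows "y \<in> N z w" "c \<in> {x, y, w}"
proof -
  have wy: "w \<in> N z x" "y \<in> N z x" using assms by auto
  note D = N_D[OF wy(1)] N_D[OF wy(2)]
  show c: "c \<in> {x, y, w}"
  proof (rule ccontr)
    assume "c \<notin> {x, y, w}"
    then show False using assms(2,5) wy D unfolding bad_def by blast
  qed
  consider "c = x" | "c = y" | "c = w" using c by blast
  then show "y \<in> N z w"
  proof cases
    case 1
    then obtain u where u: "u \<noteq> x" "u \<noteq> y" "N z y = {u, x}" "N z u = {y, x}"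
      using bad_triangle[of z x y] assms wy by metis
    have "u \<in> N z x" using u N_perm by blast
    then have "u = w" using u assms by auto
    then show ?thesis using u by auto
  next
    case 2
    have "x \<in> N z y" using wy N_perm by blast
    then obtain u where u: "u \<noteq> y" "u \<noteq> x" "N z x = {u, y}" "N z u = {x, y}"
      using bad_triangle[of z y x] assms 2 by metis
    then have "u = w" using assms by blast
    then show ?thesis using u by auto
  next
    case 3
    have "x \<in> N z w" using wy N_perm by blast
    then obtain u where u: "u \<noteq> w" "u \<noteq> x" "N z x = {u, w}" "N z u = {x, w}"
      using bad_triangle[of z w x] assms 3 by metis
    then have "u = y" using assms by blast
    then show ?thesis using u N_perm by blast
  qed
qed

section \<open>Winning patterns after the first two moves\<close>

definition double_threat :: "'a \<Rightarrow> 'a \<Rightarrow> bool" where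
  "double_threat x y \<longleftrightarrow> (\<exists>z\<in>X - {x, y}. \<exists>c\<in>N x z - {y}. \<exists>d\<in>N x z - {y}. c \<noteq> d)"

text \<open>Xeno plays \<open>z\<close>, Ophelia must answer \<open>w\<close>, and \<open>t\<close>
  then threatens \<open>c\<close> and \<open>d\<close>. The bound on \<open>N y w\<close> leaves her
  no winning reply.\<close>

definition forced_double_threat :: "'a \<Rightarrow> 'a \<Rightarrow> bool" where
  "forced_double_threat x y \<longleftrightarrow> (\<exists>z w t c d. distinct [x, y, z, w, t] \<and> {z, w, t} \<subseteq> X \<and>
     w \<in> N x z \<and> N y w \<subseteq> {x, z, t} \<and> c \<in> N x t - {y, z, w} \<and> d \<in> N z t - {x, y, w} \<and> c \<noteq> d)"

text \<open>Here any two points lie on one line: \<open>w\<close> is third on \<open>x, z\<close>,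
  \<open>t\<close> on \<open>y, w\<close>, \<open>c\<close> on \<open>x, t\<close> and
  \<open>d\<close> on \<open>z, t\<close>.\<close>

lemma forced_double_threat_if_all_matched:
  assumes "card X \<ge> 5" "\<And>x. x \<in> X \<Longrightarrow> matched x" "x \<in> X" "y \<in> X" "x \<noteq> y"
  shows "forced_double_threat x y"
proof -
  have uniq: "c = d" if "c \<in> N a b" "d \<in> N a b" for a b c d
    using assms(2) that N_D[OF that(1)] unfolding matched_def by blast
  obtain e where e: "e \<in> N x y" using N_nonempty assms by metis
  have "\<exists>z. z \<in> X - {x, y, e}"
  proof (rule ccontr)
    assume "\<not> ?thesis"
    then have "card X \<le> card {x, y, e}" by (intro card_mono) auto
    also have "\<dots> \<le> 3" by (simp add: card_insert_if)
    finally show False using assms(1) by simp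
  qed
  then obtain z where z: "z \<in> X" "z \<noteq> x" "z \<noteq> y" "z \<notin> N x y" using uniq e by blast
  obtain w where w: "w \<in> N x z" using N_nonempty assms z by metis
  note wD = N_D[OF w]
  have wy: "w \<noteq> y" using w z N_perm by blast
  obtain t where t: "t \<in> N y w" using N_nonempty[of y w] assms wD wy by metis
  note tD = N_D[OF t]
  have w': "z \<in> N x w" "x \<in> N z w" using w N_perm by blast+
  have tx: "t \<noteq> x" using t w' uniq N_perm z by metis
  have tz: "t \<noteq> z" using t w' uniq N_perm assms by metis
  obtain c where c: "c \<in> N x t" using N_nonempty[of x t] assms tD tx by metis
  obtain d where d: "d \<in> N z t" using N_nonempty[of z t] z tD tz by metis
  have t': "w \<in> N y t" using t N_perm by blast
  have "c \<noteq> d" using c d uniq N_perm z by metis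
  moreover have "c \<noteq> y" using c t' uniq N_perm wD by metis
  moreover have "c \<noteq> w" "c \<noteq> z" using c w w' uniq N_perm tz tD by metis+
  moreover have "d \<noteq> y" using d t' uniq N_perm wD by metis
  moreover have "d \<noteq> w" "d \<noteq> x" using d w w' uniq N_perm tx tD by metis+
  moreover have "N y w \<subseteq> {x, z, t}" using t uniq by blast
  moreover have "distinct [x, y, z, w, t]" using assms z wD wy tD tx tz by auto
  moreover have "{z, w, t} \<subseteq> X" using z wD tD by auto
  ultimately show ?thesis unfolding forced_double_threat_def using w c d by blast
qed

text \<open>Bad replies to \<open>y\<close> and \<open>z\<close> are used besides the one to
  \<open>x\<close>: \<open>y'\<close> bounds \<open>N y w\<close>, and \<open>z'\<close> provides
  \<open>d\<close>.\<close>

lemma forced_double_threat_if_bad: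
  assumes "card X \<ge> 5" "\<And>x. x \<in> X \<Longrightarrow> \<exists>y. bad x y" "x \<in> X" "bad x y" "\<not> matched x"
  shows "forced_double_threat x y"
proof -
  have y: "y \<in> X" "y \<noteq> x" using assms(4) unfolding bad_def by blast+
  obtain y' where y': "bad y y'" using assms(2) y by blast
  obtain z w where "w \<noteq> y" "w \<noteq> z" "N x z = {w, y}" "N x w = {z, y}" "w \<noteq> y'" "z \<noteq> y"
  proof -
    obtain z where z: "z \<in> N x y" using N_nonempty assms(3) y by metis
    obtain w where w: "w \<noteq> y" "w \<noteq> z" "N x z = {w, y}" "N x w = {z, y}"
      using bad_triangle[OF assms(3-5) z] by blast
    show thesis
      using that[of w z] that[of z w] w N_D[OF z] by (cases "w = y'") auto
  qed
  note zw = this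
  have tri: "w \<in> N x z" "y \<in> N x z" "y \<in> N x w" using zw by auto
  note D = N_D[OF tri(1)]
  have zx: "N z x = {w, y}" using zw N_perm by blast
  have "\<not> matched z" using zx zw D unfolding matched_def by blast
  obtain z' where z': "bad z z'" using assms(2) D by blast
  have yzw: "y \<in> N z w" and z'3: "z' \<in> {x, y, w}"
    using N_pair_adjacent[OF _ z' \<open>\<not> matched z\<close> zx] zw D by auto
  have tri': "x \<in> N y w" "z \<in> N y w" "x \<in> N z y" "w \<in> N z y" "x \<in> N z w" "y \<in> N z w" "z \<in> N x y"
    using tri yzw N_perm by blast+
  \<comment> \<open>In the link of \<open>y\<close>, the point \<open>w\<close> is adjacent to
    \<open>x\<close> and \<open>z\<close>. As \<open>w \<noteq> y'\<close>, it has at most one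
    neighbour besides \<open>y'\<close>, so \<open>y'\<close> is \<open>x\<close> or
    \<open>z\<close> and there is no third neighbour.\<close>
  have Nyw: "N y w \<subseteq> {x, z}"
  proof
    fix r assume "r \<in> N y w"
    then show "r \<in> {x, z}" using y' tri' D zw(1,5) unfolding bad_def
      by (smt (verit, best) DiffI insertE insertI1 insertI2 singletonD)
  qed
  have "\<exists>t. t \<in> X - {x, y, z, w}"
  proof (rule ccontr)
    assume "\<not> ?thesis"
    then have "card X \<le> card {x, y, z, w}" by (intro card_mono) auto
    also have "\<dots> \<le> 4" by (simp add: card_insert_if)
    finally show False using assms(1) by simp
  qed
  then obtain t where t: "t \<in> X" "t \<noteq> x" "t \<noteq> y" "t \<noteq> z" "t \<noteq> w" by blast
  obtain c where c: "c \<in> N x t" "c \<noteq> y" using bad_partner[OF assms(3-5)] t by blast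
  have cN: "c \<noteq> z" "c \<noteq> w" using c zw t N_perm by blast+
  obtain d where d: "d \<in> N z t" "d \<noteq> z'"
    using bad_partner[OF _ z' \<open>\<not> matched z\<close>] t D z'3 by blast
  have dx: "d \<noteq> x" using d zx t N_perm by blast
  have dy: "d \<noteq> y"
  proof
    assume "d = y"
    then have "t \<in> N z y" using d N_perm by blast
    then show False using z' z'3 tri' D zw t d \<open>d = y\<close> y unfolding bad_def by blast
  qed
  have dw: "d \<noteq> w"
  proof
    assume "d = w"
    then have "t \<in> N z w" using d N_perm by blast
    then show False using z' z'3 tri' D zw t d \<open>d = w\<close> y unfolding bad_def by blast
  qed
  \<comment> \<open>Otherwise two blocks on the pair \<open>t, c\<close>, each of multiplicity above
    \<open>l/2\<close>, would exceed \<open>l\<close>.\<close>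
  have "c \<noteq> d"
  proof
    assume "c = d"
    have "2 * wt x t c > l"
      using bad_heavy[OF assms(4) _ c(1) c(2) tri'(7)] t cN by simp
    moreover have "2 * wt z t d > l"
    proof -
      obtain q where "q \<in> N z z'" "q \<in> {x, y, w}" using z'3 tri' zx by blast
      then show ?thesis using bad_heavy[OF z' _ d(1) d(2)] t dx dy dw z'3 by blast
    qed
    moreover have "wt t c x + wt t c z \<le> l"
      using sum_wt_le[of t c "{x, z}"] N_D[OF c(1)] D by simp
    moreover have "wt t c x = wt x t c" "wt t c z = wt z t d"
      using wt_perm \<open>c = d\<close> by metis+
    ultimately show False by linarith
  qed
  moreover have "distinct [x, y, z, w, t]" using y zw D t by auto
  ultimately show ?thesis
    unfolding forced_double_threat_def using tri(1) Nyw c cN d dx dy dw t D by blast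
qed

lemma exists_winning_opening:
  assumes "card X \<ge> 5"
  shows "\<exists>x\<in>X. \<forall>y\<in>X - {x}. double_threat x y \<or> forced_double_threat x y"
proof -
  have not_bad: "double_threat x y" if "\<not> bad x y" "y \<in> X - {x}" for x y
    using that unfolding bad_def double_threat_def by blast
  have ne: "X \<noteq> {}" using assms by auto
  consider x where "x \<in> X" "\<forall>y. \<not> bad x y"
    | "\<forall>x\<in>X. matched x"
    | x where "x \<in> X" "\<not> matched x" "\<forall>x\<in>X. \<exists>y. bad x y"
    by blast
  then show ?thesis
  proof cases
    case 1
    then show ?thesis using not_bad by blast
  next
    case 2
    then show ?thesis using forced_double_threat_if_all_matched[OF assms] ne by blast
  next
    case 3
    then show ?thesis using forced_double_threat_if_bad[OF assms, of x] not_bad by blast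
  qed
qed

section \<open>Playing out the patterns\<close>

lemma has_block_card:
  assumes "has_block \<B> S" "finite S"
  shows "card S \<ge> 3"
  using assms triple_system card_mono unfolding has_block_def triple_system_def by metis

lemma has_block_N: "c \<in> N a b \<Longrightarrow> {a, b, c} \<subseteq> S \<Longrightarrow> has_block \<B> S"
  unfolding has_block_def N_def by blast

lemma has_block_triple:
  assumes "has_block \<B> {a, b, c}"
  shows "c \<in> N a b"
proof -
  from assms obtain s where s: "s \<in># \<B>" "s \<subseteq> {a, b, c}" by (auto simp: has_block_def)
  then have "card {a, b, c} \<le> card s"
    using triple_system by (simp add: triple_system_def card_insert_if)
  then have "s = {a, b, c}" using s(2) by (intro card_seteq) auto
  then show ?thesis using s by (simp add: N_def)
qed

lemma not_has_block_small [simp]: "\<not> has_block \<B> {}" "\<not> has_block \<B> {a}" "\<not> has_block \<B> {a, b}"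
  using has_block_card[of "{}"] has_block_card[of "{a}"] has_block_card[of "{a, b}"]
  by (auto simp: card_insert_if split: if_splits)

lemma xeno_forces_double_threat:
  assumes "x \<in> X" "y \<in> X - {x}" "double_threat x y"
  shows "xeno_forces X \<B> [x, y]"
proof -
  obtain z c d where z: "z \<in> X" "z \<noteq> x" "z \<noteq> y" "c \<in> N x z" "d \<in> N x z" "c \<noteq> y" "d \<noteq> y" "c \<noteq> d"
    using assms(3) unfolding double_threat_def by blast
  show ?thesis
  proof (rule xeno_forces.continue[where a = z])
    show "insert z (set [x, y]) \<noteq> X" using z N_D(3)[OF z(4)] N_D(3)[OF z(5)] N_D(5,6)[OF z(4)] N_D(5,6)[OF z(5)] by auto
    fix b assume b: "b \<in> X - insert z (set [x, y])"
    obtain e where e: "e \<in> N x z" "e \<noteq> b" "e \<noteq> y" using z by metis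
    have "xeno_forces X \<B> [x, y, z, b]"
      by (rule xeno_forces.complete[where a = e])
        (use e N_D[OF e(1)] in \<open>auto simp: undecided_def intro: has_block_N[OF e(1)]\<close>)
    then show "xeno_forces X \<B> ([x, y] @ [z, b])" by simp
  qed (use z in \<open>auto simp: undecided_def\<close>)
qed

lemma xeno_forces_forced_double_threat:
  assumes "x \<in> X" "y \<in> X - {x}" "forced_double_threat x y"
  shows "xeno_forces X \<B> [x, y]"
proof -
  obtain z w t c d where *: "distinct [x, y, z, w, t]" "{z, w, t} \<subseteq> X" "w \<in> N x z" "N y w \<subseteq> {x, z, t}"
    "c \<in> N x t - {y, z, w}" "d \<in> N z t - {x, y, w}" "c \<noteq> d"
    using assms(3) unfolding forced_double_threat_def by blast
  have c: "c \<in> N x t" and d: "d \<in> N z t" using * by auto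
  have win: "xeno_forces X \<B> [x, y, z, w]"
  \<comment> \<open>If \<open>t\<close> already completes a block, the game ends there and the
    double threat is never played.\<close>
  proof (cases "has_block \<B> {x, z, t}")
    case True
    show ?thesis
      by (rule xeno_forces.complete[where a = t]) (use * True in \<open>auto simp: undecided_def\<close>)
  next
    case False
    show ?thesis
    proof (rule xeno_forces.continue[where a = t])
      show "insert t (set [x, y, z, w]) \<noteq> X" using * N_D[OF c] by auto
      fix s assume s: "s \<in> X - insert t (set [x, y, z, w])"
      \<comment> \<open>A block on \<open>y, w, s\<close> would put \<open>s\<close> into
        \<open>N y w\<close>, but \<open>x, z, t\<close> are all taken.\<close>
      have und: "undecided \<B> [x, y, z, w, t, s]"
        using False s *(4) has_block_triple[of y w s] by (auto simp: undecided_def)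
      have "xeno_forces X \<B> [x, y, z, w, t, s]"
      proof (cases "c = s")
        case True
        show ?thesis
          by (rule xeno_forces.complete[where a = d])
            (use und * True N_D[OF d] in \<open>auto intro: has_block_N[OF d]\<close>)
      next
        case False
        show ?thesis
          by (rule xeno_forces.complete[where a = c])
            (use und * False N_D[OF c] in \<open>auto intro: has_block_N[OF c]\<close>)
      qed
      then show "xeno_forces X \<B> ([x, y, z, w] @ [t, s])" by simp
    qed (use * in \<open>auto simp: undecided_def\<close>)
  qed
  show ?thesis
  proof (rule xeno_forces.continue[where a = z])
    show "insert z (set [x, y]) \<noteq> X" using * by auto
    fix b assume b: "b \<in> X - insert z (set [x, y])"
    have "xeno_forces X \<B> [x, y, z, b]"
    proof (cases "b = w")
      case False
      show ?thesis
        by (rule xeno_forces.complete[where a = w])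
          (use * False in \<open>auto simp: undecided_def intro: has_block_N[OF *(3)]\<close>)
    qed (use win in simp)
    then show "xeno_forces X \<B> ([x, y] @ [z, b])" by simp
  qed (use * in \<open>auto simp: undecided_def\<close>)
qed

lemma xeno_forces_Nil:
  assumes "card X \<ge> 5"
  shows "xeno_forces X \<B> []"
proof -
  obtain x where x: "x \<in> X" "\<forall>y\<in>X - {x}. double_threat x y \<or> forced_double_threat x y"
    using exists_winning_opening[OF assms] by blast
  show ?thesis
  proof (rule xeno_forces.continue[where a = x])
    show "insert x (set []) \<noteq> X" using assms by auto
    fix y assume "y \<in> X - insert x (set [])"
    then show "xeno_forces X \<B> ([] @ [x, y])"
      using x xeno_forces_double_threat xeno_forces_forced_double_threat by force
  qed (use x in \<open>auto simp: undecided_def\<close>)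
qed

text \<open>Xeno needs three points, and his third is the fifth move of the game.\<close>

lemma xeno_winning_strategy_imp_card:
  assumes "xeno_winning_strategy X \<B> \<sigma>"
  shows "card X \<ge> 5"
proof -
  obtain p where p: "finished X \<B> p" "follows \<sigma> p"
    using exists_finished_follows[OF finite_X] assms unfolding xeno_winning_strategy_def by blast
  then have "has_block \<B> (xeno_points p)"
    using assms by (simp add: xeno_winning_strategy_def xeno_wins_def)
  then have "3 \<le> card (xeno_points p)" using has_block_card finite_points by blast
  also have "\<dots> \<le> (length p + 1) div 2" using card_xeno_ophelia_points_le by blast
  finally have "5 \<le> length p" by linarith
  also have "\<dots> \<le> card X"
    using p(1) finite_X by (metis card_mono distinct_card finished_def position_def)
  finally show ?thesis .
qed

end

theorem theorem3p5:
  fixes X :: "'a set" and \<B> :: "'a set multiset" and v l :: nat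
  assumes "v > 0" and "l > 0"
    and "triple_system X \<B> v l"
  shows "(\<exists>\<sigma>. xeno_winning_strategy X \<B> \<sigma>) \<longleftrightarrow> v \<ge> 5"
proof -
  interpret covering_triple_system X \<B> v l
    using assms by unfold_locales
  have "card X = v" using assms by (simp add: triple_system_def)
  then show ?thesis
    using xeno_winning_strategy_imp_card xeno_forces_imp_winning_strategy[OF xeno_forces_Nil] by blast
qed

end
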